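(* Let $H_n$, $n\in\mathbb N$, be Hilbert spaces, $X_n\subset H_n$ closed subspaces, and $e=(e^{(n)})_{n\in\mathbb N}$ a stabilizing sequence of unit vectors with $e^{(n)}\in X_n\subset H_n$ for all $n\in\mathbb N$. Let $\mathcal H_e=\bigotimes_{e,n\in\mathbb N}H_n$ and, for $l\in\mathbb N$, let $$\mathcal H_e^{l}(X)=\bigotimes_{k=1}^lH_k\otimes\bigotimes_{e,\,k=l+1}^\infty X_k\subset\mathcal H_e.$$ Then $$\mathcal H_e=\overline{\bigcup_{l\ge1}\mathcal H_e^{l}(X)}.$$
   Context: Hilbert spaces are separable. Infinite tensor product: choose an orthonormal basis of each $H_n$ containing $e^{(n)}$ (and extending an orthonormal basis of $X_n$ containing $e^{(n)}$); $\bigotimes_{e,n}H_n$ is the Hilbert space with orthonormal basis all formal products $\bigotimes_n b_n$ of basis vectors $b_n\in H_n$ with $b_n=e^{(n)}$ for all but finitely many $n$. $\mathcal H_e^{l}(X)$ is the closed linear span of those products with $b_n\in X_n$ for all $n\ge l+1$. *)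

theory Defs
  imports "HOL-Analysis.Analysis" "HOL-Library.Function_Algebras"
begin

text \<open>
  Real and complex Hilbert spaces are treated uniformly: the scalar field is a type of the
  following class, whose instances are \<^typ>\<open>real\<close> (with the identity as conjugation) and
  \<^typ>\<open>complex\<close> (with \<^const>\<open>cnj\<close>); by the Gelfand--Mazur theorem there are no others up to
  isomorphism.
\<close>

class real_or_complex = real_normed_field + banach +
  fixes sconj :: "'a \<Rightarrow> 'a"
  assumes sconj_add: "sconj (x + y) = sconj x + sconj y"
    and mult_sconj: "x * sconj x = (norm x)\<^sup>2 *\<^sub>R 1"

instantiation real :: real_or_complex
begin
definition sconj_real :: "real \<Rightarrow> real" where "sconj_real x = x"
instance by standard (simp_all add: sconj_real_def power2_eq_square)
end

instantiation complex :: real_or_complex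
begin
definition sconj_complex :: "complex \<Rightarrow> complex" where "sconj_complex x = cnj x"
instance by standard (simp_all add: sconj_complex_def scaleR_conv_of_real complex_norm_square del: of_real_power)
end


section \<open>Hilbert spaces on a carrier\<close>

definition ip_norm :: "('a \<Rightarrow> 'a \<Rightarrow> 'k::real_or_complex) \<Rightarrow> 'a \<Rightarrow> real"
  where "ip_norm ip x = sqrt (norm (ip x x))"

definition ip_dist :: "('a::ab_group_add \<Rightarrow> 'a \<Rightarrow> 'k::real_or_complex) \<Rightarrow> 'a \<Rightarrow> 'a \<Rightarrow> real"
  where "ip_dist ip x y = ip_norm ip (x - y)"

definition ip_topology ::
    "'a::ab_group_add set \<Rightarrow> ('a \<Rightarrow> 'a \<Rightarrow> 'k::real_or_complex) \<Rightarrow> 'a topology"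
  where "ip_topology H ip = Metric_space.mtopology H (ip_dist ip)"

text \<open>
  The carrier \<open>H\<close> is a linear subspace of an ambient vector space that carries no topology, and
  \<open>ip\<close> is only constrained on \<open>H\<close>. This allows families of Hilbert spaces that are indexed
  by natural numbers; it is no restriction on such a family, since all its members embed into
  their algebraic direct sum.
\<close>

locale hilbert_space = vector_space smul
  for smul :: "'k::real_or_complex \<Rightarrow> 'a::ab_group_add \<Rightarrow> 'a" +
  fixes H :: "'a set" and ip :: "'a \<Rightarrow> 'a \<Rightarrow> 'k"
  assumes subspace_carrier: "subspace H"
    and ip_add: "\<lbrakk>x \<in> H; y \<in> H; z \<in> H\<rbrakk> \<Longrightarrow> ip (x + y) z = ip x z + ip y z"
    and ip_scale: "\<lbrakk>x \<in> H; y \<in> H\<rbrakk> \<Longrightarrow> ip (smul c x) y = c * ip x y"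
    and ip_conj: "\<lbrakk>x \<in> H; y \<in> H\<rbrakk> \<Longrightarrow> ip y x = sconj (ip x y)"
    and ip_pos: "\<lbrakk>x \<in> H; x \<noteq> 0\<rbrakk> \<Longrightarrow> \<exists>r>0. ip x x = of_real r"
    and complete: "Metric_space.mcomplete H (ip_dist ip)"

definition closed_subspace ::
    "('k \<Rightarrow> 'a \<Rightarrow> 'a) \<Rightarrow> 'a::ab_group_add set \<Rightarrow> ('a \<Rightarrow> 'a \<Rightarrow> 'k::real_or_complex) \<Rightarrow> 'a set \<Rightarrow> bool"
  where "closed_subspace smul H ip X \<longleftrightarrow>
    module.subspace smul X \<and> X \<subseteq> H \<and> closedin (ip_topology H ip) X"

definition closed_span ::
    "('k \<Rightarrow> 'a \<Rightarrow> 'a) \<Rightarrow> 'a::ab_group_add set \<Rightarrow> ('a \<Rightarrow> 'a \<Rightarrow> 'k::real_or_complex) \<Rightarrow> 'a set \<Rightarrow> 'a set"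
  where "closed_span smul H ip S = ip_topology H ip closure_of (module.span smul S)"

definition orthonormal :: "('a \<Rightarrow> 'a \<Rightarrow> 'k::real_or_complex) \<Rightarrow> 'a set \<Rightarrow> bool"
  where "orthonormal ip S \<longleftrightarrow> (\<forall>x\<in>S. \<forall>y\<in>S. ip x y = (if x = y then 1 else 0))"

definition orthonormal_basis ::
    "('k \<Rightarrow> 'a \<Rightarrow> 'a) \<Rightarrow> 'a::ab_group_add set \<Rightarrow> ('a \<Rightarrow> 'a \<Rightarrow> 'k::real_or_complex) \<Rightarrow> 'a set \<Rightarrow> bool"
  where "orthonormal_basis smul H ip S \<longleftrightarrow>
    S \<subseteq> H \<and> orthonormal ip S \<and> closed_span smul H ip S = H"


section \<open>The Hilbert space with a prescribed orthonormal basis\<close>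

definition fun_scale :: "'k::times \<Rightarrow> ('i \<Rightarrow> 'k) \<Rightarrow> 'i \<Rightarrow> 'k"
  where "fun_scale c f = (\<lambda>i. c * f i)"

definition ell2 :: "'i set \<Rightarrow> ('i \<Rightarrow> 'k::real_or_complex) set"
  where "ell2 I = {f. (\<forall>i. i \<notin> I \<longrightarrow> f i = 0) \<and> (\<lambda>i. (norm (f i))\<^sup>2) summable_on I}"

definition ell2_inner :: "'i set \<Rightarrow> ('i \<Rightarrow> 'k::real_or_complex) \<Rightarrow> ('i \<Rightarrow> 'k) \<Rightarrow> 'k"
  where "ell2_inner I f g = (\<Sum>\<^sub>\<infinity>i\<in>I. f i * sconj (g i))"

definition ell2_unit :: "'i \<Rightarrow> 'i \<Rightarrow> 'k::real_or_complex"
  where "ell2_unit i = (\<lambda>j. if j = i then 1 else 0)"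


section \<open>The infinite tensor product along a stabilizing sequence\<close>

text \<open>
  Factors are numbered from 1. A formal product of vectors \<open>b n\<close> is represented by the function
  \<open>b\<close>, extended by \<^const>\<open>undefined\<close> at index 0 to make the representation unique. \<open>B n\<close> is the chosen
  orthonormal basis of the \<open>n\<close>-th factor. The unit vector of
  \<^term>\<open>ell2 (formal_products B e)\<close> at \<open>b\<close> is the formal product as an element of the tensor product.
\<close>

definition formal_products :: "(nat \<Rightarrow> 'a set) \<Rightarrow> (nat \<Rightarrow> 'a) \<Rightarrow> (nat \<Rightarrow> 'a) set"
  where "formal_products B e = {b \<in> (\<Pi>\<^sub>E n\<in>{1..}. B n). finite {n \<in> {1..}. b n \<noteq> e n}}"

definition tensor_space ::
    "(nat \<Rightarrow> 'a set) \<Rightarrow> (nat \<Rightarrow> 'a) \<Rightarrow> ((nat \<Rightarrow> 'a) \<Rightarrow> 'k::real_or_complex) set"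
  where "tensor_space B e = ell2 (formal_products B e)"

definition tensor_inner ::
    "(nat \<Rightarrow> 'a set) \<Rightarrow> (nat \<Rightarrow> 'a) \<Rightarrow>
     ((nat \<Rightarrow> 'a) \<Rightarrow> 'k::real_or_complex) \<Rightarrow> ((nat \<Rightarrow> 'a) \<Rightarrow> 'k) \<Rightarrow> 'k"
  where "tensor_inner B e = ell2_inner (formal_products B e)"

definition tensor_level ::
    "(nat \<Rightarrow> 'a set) \<Rightarrow> (nat \<Rightarrow> 'a) \<Rightarrow> (nat \<Rightarrow> 'a set) \<Rightarrow> nat \<Rightarrow>
     ((nat \<Rightarrow> 'a) \<Rightarrow> 'k::real_or_complex) set"
  where "tensor_level B e X l =
    closed_span fun_scale (tensor_space B e) (tensor_inner B e)
      (ell2_unit ` {b \<in> formal_products B e. \<forall>n\<ge>l + 1. b n \<in> X n})"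

section \<open>The model is a Hilbert space with the prescribed orthonormal basis\<close>

lemma norm_sconj: "norm (sconj x) = norm (x :: 'k::real_or_complex)"
proof (cases "x = 0")
  case True
  then show ?thesis using sconj_add[of "0::'k" 0] by simp
next
  case False
  have "norm x * norm (sconj x) = norm x * norm x"
    using arg_cong[OF mult_sconj[of x], of norm] by (simp add: norm_mult power2_eq_square)
  then show ?thesis using False by simp
qed

lemma sconj_eqI: "x \<noteq> 0 \<Longrightarrow> x * y = (norm x)\<^sup>2 *\<^sub>R 1 \<Longrightarrow> sconj x = (y :: 'k::real_or_complex)"
  by (metis mult_sconj mult_left_cancel)

lemma sconj_0 [simp]: "sconj 0 = (0 :: 'k::real_or_complex)"
  using norm_sconj[of "0::'k"] by simp

lemma sconj_1 [simp]: "sconj 1 = (1 :: 'k::real_or_complex)"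
  by (rule sconj_eqI) auto

lemma sconj_scaleR: "sconj (r *\<^sub>R x) = r *\<^sub>R sconj (x :: 'k::real_or_complex)"
proof (cases "r = 0 \<or> x = 0")
  case False
  then show ?thesis
    by (intro sconj_eqI) (auto simp: mult_sconj power2_eq_square mult_ac)
qed auto

lemma sconj_mult: "sconj (x * y) = sconj x * sconj (y :: 'k::real_or_complex)"
proof (cases "x = 0 \<or> y = 0")
  case False
  have "x * y * (sconj x * sconj y) = (x * sconj x) * (y * sconj y)"
    by (simp add: mult_ac)
  also have "\<dots> = (norm (x * y))\<^sup>2 *\<^sub>R 1"
    by (simp add: mult_sconj norm_mult power_mult_distrib)
  finally show ?thesis
    using False by (intro sconj_eqI) auto
qed auto

lemma sconj_sconj [simp]: "sconj (sconj x) = (x :: 'k::real_or_complex)"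
proof (cases "x = 0")
  case False
  then have "sconj x \<noteq> 0" using norm_sconj[of x] by auto
  then show ?thesis
    by (rule sconj_eqI) (metis mult.commute mult_sconj norm_sconj)
qed auto

lemma bounded_linear_sconj: "bounded_linear (sconj :: 'k::real_or_complex \<Rightarrow> 'k)"
  by (rule bounded_linear_intro[where K = 1]) (auto simp: sconj_add sconj_scaleR norm_sconj)

interpretation fun_scale: vector_space "fun_scale :: 'k::field \<Rightarrow> ('i \<Rightarrow> 'k) \<Rightarrow> 'i \<Rightarrow> 'k"
  by unfold_locales (auto simp: fun_scale_def fun_eq_iff algebra_simps)

lemma ell2_summable:
  assumes "f \<in> ell2 I" "g \<in> ell2 I"
  shows "(\<lambda>i. f i * sconj (g i :: 'k::real_or_complex)) summable_on I"
proof -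
  have "(\<lambda>i. (norm (f i))\<^sup>2 + (norm (g i))\<^sup>2) summable_on I"
    using assms by (intro summable_on_add) (auto simp: ell2_def)
  moreover have "norm (f i * sconj (g i)) \<le> (norm (f i))\<^sup>2 + (norm (g i))\<^sup>2" for i
    using sum_squares_bound[of "norm (f i)" "norm (g i)"]
      mult_nonneg_nonneg[OF norm_ge_zero[of "f i"] norm_ge_zero[of "g i"]]
    unfolding norm_mult norm_sconj by linarith
  ultimately have "(\<lambda>i. norm (f i * sconj (g i))) summable_on I"
    by (rule summable_on_comparison_test) auto
  then show ?thesis
    by (rule abs_summable_summable)
qed

lemma ell2_summable_add:
  assumes "f \<in> ell2 I" "g \<in> ell2 I"
  shows "(\<lambda>i. (norm (f i + (g i :: 'k::real_or_complex)))\<^sup>2) summable_on I"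
proof -
  have "(\<lambda>i. 2 * ((norm (f i))\<^sup>2 + (norm (g i))\<^sup>2)) summable_on I"
    using assms by (intro summable_on_cmult_right summable_on_add) (auto simp: ell2_def)
  moreover have "(norm (f i + g i))\<^sup>2 \<le> 2 * ((norm (f i))\<^sup>2 + (norm (g i))\<^sup>2)" for i
  proof -
    have "(norm (f i + g i))\<^sup>2 \<le> (norm (f i) + norm (g i))\<^sup>2"
      by (intro power_mono norm_triangle_ineq) auto
    also have "\<dots> \<le> 2 * ((norm (f i))\<^sup>2 + (norm (g i))\<^sup>2)"
      using sum_squares_bound[of "norm (f i)" "norm (g i)"] by (simp add: power2_sum)
    finally show ?thesis .
  qed
  ultimately show ?thesis
    by (rule summable_on_comparison_test) auto
qed

lemma ell2_subspace: "fun_scale.subspace (ell2 I :: ('i \<Rightarrow> 'k::real_or_complex) set)"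
proof (rule fun_scale.subspaceI)
  fix c :: 'k and f :: "'i \<Rightarrow> 'k" assume "f \<in> ell2 I"
  then show "fun_scale c f \<in> ell2 I"
    by (auto simp: ell2_def fun_scale_def norm_mult power_mult_distrib intro: summable_on_cmult_right)
next
  fix f g :: "'i \<Rightarrow> 'k" assume "f \<in> ell2 I" "g \<in> ell2 I"
  then show "f + g \<in> ell2 I"
    using ell2_summable_add[of f I g] by (auto simp: ell2_def)
qed (auto simp: ell2_def)

lemma ell2_inner_self:
  assumes "f \<in> ell2 I"
  shows "ell2_inner I f f = of_real (\<Sum>\<^sub>\<infinity>i\<in>I. (norm (f i :: 'k::real_or_complex))\<^sup>2)"
  unfolding ell2_inner_def mult_sconj scaleR_conv_of_real mult_1_right
  by (rule infsumI, subst has_sum_of_real_iff) (use assms in \<open>auto simp: ell2_def\<close>)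

lemma ell2_norm_sq:
  assumes "f \<in> ell2 I"
  shows "(ip_norm (ell2_inner I) f)\<^sup>2 = (\<Sum>\<^sub>\<infinity>i\<in>I. (norm (f i :: 'k::real_or_complex))\<^sup>2)"
  using assms by (simp add: ip_norm_def ell2_inner_self infsum_nonneg)

lemma ell2_norm_nonneg [simp]: "0 \<le> ip_norm (ip :: 'a \<Rightarrow> 'a \<Rightarrow> 'k::real_or_complex) f"
  by (simp add: ip_norm_def)

lemma ell2_norm_eq_0:
  assumes "f \<in> ell2 I"
  shows "ip_norm (ell2_inner I) f = 0 \<longleftrightarrow> f = (0 :: 'i \<Rightarrow> 'k::real_or_complex)"
proof
  assume "ip_norm (ell2_inner I) f = 0"
  then have "(\<Sum>\<^sub>\<infinity>i\<in>I. (norm (f i))\<^sup>2) = 0"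
    using ell2_norm_sq[OF assms] by simp
  then have "f i = 0" if "i \<in> I" for i
    using nonneg_infsum_le_0D[of "\<lambda>i. (norm (f i))\<^sup>2" I] that assms by (auto simp: ell2_def)
  then show "f = 0"
    using assms by (auto simp: ell2_def fun_eq_iff)
qed (simp add: ip_norm_def ell2_inner_def)

lemma ell2_L2_le:
  assumes "f \<in> ell2 I" "finite F"
  shows "L2_set (\<lambda>i. norm (f i :: 'k::real_or_complex)) F \<le> ip_norm (ell2_inner I) f"
proof -
  have "(\<Sum>i\<in>F. (norm (f i))\<^sup>2) = (\<Sum>i\<in>F \<inter> I. (norm (f i))\<^sup>2)"
    using assms by (intro sum.mono_neutral_right) (auto simp: ell2_def)
  also have "\<dots> \<le> (\<Sum>\<^sub>\<infinity>i\<in>I. (norm (f i))\<^sup>2)"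
    using assms by (intro finite_sum_le_infsum) (auto simp: ell2_def)
  finally show ?thesis
    unfolding L2_set_def by (intro real_le_lsqrt) (auto simp: ell2_norm_sq[OF assms(1)])
qed

lemma ell2I:
  assumes "\<And>i. i \<notin> I \<Longrightarrow> f i = 0"
    and "\<And>F. finite F \<Longrightarrow> F \<subseteq> I \<Longrightarrow> L2_set (\<lambda>i. norm (f i :: 'k::real_or_complex)) F \<le> K"
    and "0 \<le> K"
  shows "f \<in> ell2 I" "ip_norm (ell2_inner I) f \<le> K"
proof -
  have *: "(\<Sum>i\<in>F. (norm (f i))\<^sup>2) \<le> K\<^sup>2" if "finite F" "F \<subseteq> I" for F
    using assms(2)[OF that] unfolding L2_set_def by (rule sqrt_le_D)
  have "(\<lambda>i. (norm (f i))\<^sup>2) summable_on I"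
    by (rule nonneg_bounded_partial_sums_imp_summable_on[where C = "K\<^sup>2"])
       (use * in \<open>auto intro!: eventually_finite_subsets_at_top_weakI\<close>)
  then show f: "f \<in> ell2 I"
    using assms(1) by (auto simp: ell2_def)
  then have "(ip_norm (ell2_inner I) f)\<^sup>2 \<le> K\<^sup>2"
    unfolding ell2_norm_sq[OF f] using *
    by (intro infsum_le_finite_sums) (auto simp: ell2_def)
  then show "ip_norm (ell2_inner I) f \<le> K"
    using assms(3) by (rule power2_le_imp_le)
qed

lemma ell2_norm_add:
  assumes "f \<in> ell2 I" "g \<in> ell2 I"
  shows "ip_norm (ell2_inner I) (f + g) \<le>
    ip_norm (ell2_inner I) f + ip_norm (ell2_inner I) (g :: 'i \<Rightarrow> 'k::real_or_complex)"
proof (rule ell2I(2))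
  fix F assume F: "finite F" "F \<subseteq> I"
  have "L2_set (\<lambda>i. norm ((f + g) i)) F \<le> L2_set (\<lambda>i. norm (f i) + norm (g i)) F"
    by (intro L2_set_mono) (auto intro: norm_triangle_ineq)
  also have "\<dots> \<le> L2_set (\<lambda>i. norm (f i)) F + L2_set (\<lambda>i. norm (g i)) F"
    by (rule L2_set_triangle_ineq)
  also have "\<dots> \<le> ip_norm (ell2_inner I) f + ip_norm (ell2_inner I) g"
    by (intro add_mono ell2_L2_le assms F)
  finally show "L2_set (\<lambda>i. norm ((f + g) i)) F \<le>
    ip_norm (ell2_inner I) f + ip_norm (ell2_inner I) g" .
qed (use assms in \<open>auto simp: ell2_def\<close>)

lemma ell2_Metric_space:
  "Metric_space (ell2 I) (ip_dist (ell2_inner I :: ('i \<Rightarrow> 'k::real_or_complex) \<Rightarrow> _ \<Rightarrow> 'k))"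
proof
  fix f g h :: "'i \<Rightarrow> 'k"
  show "0 \<le> ip_dist (ell2_inner I) f g"
    by (simp add: ip_dist_def)
  have "ell2_inner I (f - g) (f - g) = ell2_inner I (g - f) (g - f)"
    by (simp add: ell2_inner_def mult_sconj norm_minus_commute)
  then show "ip_dist (ell2_inner I) f g = ip_dist (ell2_inner I) g f"
    by (simp add: ip_dist_def ip_norm_def)
  assume f: "f \<in> ell2 I" and g: "g \<in> ell2 I"
  show "ip_dist (ell2_inner I) f g = 0 \<longleftrightarrow> f = g"
    using ell2_norm_eq_0[OF fun_scale.subspace_diff[OF ell2_subspace f g]] by (simp add: ip_dist_def)
  assume h: "h \<in> ell2 I"
  show "ip_dist (ell2_inner I) f h \<le> ip_dist (ell2_inner I) f g + ip_dist (ell2_inner I) g h"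
    using ell2_norm_add[OF fun_scale.subspace_diff[OF ell2_subspace f g]
        fun_scale.subspace_diff[OF ell2_subspace g h]]
    by (simp add: ip_dist_def)
qed

lemma ell2_complete:
  "Metric_space.mcomplete (ell2 I) (ip_dist (ell2_inner I :: ('i \<Rightarrow> 'k::real_or_complex) \<Rightarrow> _ \<Rightarrow> 'k))"
proof -
  let ?d = "ip_dist (ell2_inner I :: ('i \<Rightarrow> 'k) \<Rightarrow> _ \<Rightarrow> 'k)"
  interpret Metric_space "ell2 I" ?d
    by (rule ell2_Metric_space)
  show ?thesis
    unfolding mcomplete_def
  proof (intro allI impI)
    fix \<sigma> :: "nat \<Rightarrow> 'i \<Rightarrow> 'k" assume "MCauchy \<sigma>"
    then have \<sigma>: "\<And>n. \<sigma> n \<in> ell2 I"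
      and Cau: "\<And>\<epsilon>. \<epsilon> > 0 \<Longrightarrow> \<exists>N. \<forall>m n. N \<le> m \<longrightarrow> N \<le> n \<longrightarrow> ?d (\<sigma> m) (\<sigma> n) < \<epsilon>"
      by (auto simp: MCauchy_def)
    have diff: "\<sigma> m - \<sigma> n \<in> ell2 I" for m n
      by (intro fun_scale.subspace_diff[OF ell2_subspace] \<sigma>)
    have L2: "L2_set (\<lambda>i. norm (\<sigma> m i - \<sigma> n i)) F \<le> ?d (\<sigma> m) (\<sigma> n)" if "finite F" for m n F
      using ell2_L2_le[OF diff that] by (simp add: ip_dist_def)
    have "Cauchy (\<lambda>n. \<sigma> n i)" for i
    proof (rule metric_CauchyI)
      fix \<epsilon> :: real assume "\<epsilon> > 0"
      then obtain N where N: "\<And>m n. N \<le> m \<Longrightarrow> N \<le> n \<Longrightarrow> ?d (\<sigma> m) (\<sigma> n) < \<epsilon>"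
        using Cau by blast
      have "dist (\<sigma> m i) (\<sigma> n i) < \<epsilon>" if "N \<le> m" "N \<le> n" for m n
        using L2[of "{i}" m n] N[OF that] by (simp add: dist_norm)
      then show "\<exists>N. \<forall>m\<ge>N. \<forall>n\<ge>N. dist (\<sigma> m i) (\<sigma> n i) < \<epsilon>"
        by blast
    qed
    then have "\<exists>f. \<forall>i. (\<lambda>n. \<sigma> n i) \<longlonglongrightarrow> f i"
      by (intro choice) (auto simp: Cauchy_convergent_iff convergent_def)
    then obtain f where f: "\<And>i. (\<lambda>n. \<sigma> n i) \<longlonglongrightarrow> f i"
      by auto
    have f0: "f i = 0" if "i \<notin> I" for i
      using f[of i] \<sigma> that by (auto simp: ell2_def LIMSEQ_const_iff)
    have close: "\<exists>N. \<forall>m\<ge>N. \<sigma> m - f \<in> ell2 I \<and> ip_norm (ell2_inner I) (\<sigma> m - f) \<le> \<epsilon>"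
      if \<epsilon>: "\<epsilon> > 0" for \<epsilon>
    proof -
      obtain N where N: "\<And>m n. N \<le> m \<Longrightarrow> N \<le> n \<Longrightarrow> ?d (\<sigma> m) (\<sigma> n) < \<epsilon>"
        using Cau[OF \<epsilon>] by blast
      have "L2_set (\<lambda>i. norm ((\<sigma> m - f) i)) F \<le> \<epsilon>" if "N \<le> m" "finite F" for m F
      proof (rule LIMSEQ_le_const2)
        show "(\<lambda>n. L2_set (\<lambda>i. norm (\<sigma> m i - \<sigma> n i)) F) \<longlonglongrightarrow> L2_set (\<lambda>i. norm ((\<sigma> m - f) i)) F"
          unfolding L2_set_def by (auto intro!: tendsto_intros f)
        show "\<exists>N. \<forall>n\<ge>N. L2_set (\<lambda>i. norm (\<sigma> m i - \<sigma> n i)) F \<le> \<epsilon>"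
          using L2[OF that(2)] N[OF that(1)] by (meson less_imp_le order.trans)
      qed
      then show ?thesis
        using \<epsilon> ell2I[of I "\<sigma> _ - f" \<epsilon>] \<sigma> f0
        by (auto simp: ell2_def intro!: exI[of _ N])
    qed
    obtain N where "\<sigma> N - f \<in> ell2 I"
      using close[of 1] by auto
    from fun_scale.subspace_diff[OF ell2_subspace \<sigma>[of N] this] have fI: "f \<in> ell2 I"
      by simp
    have "limitin mtopology \<sigma> f sequentially"
      unfolding limit_metric_sequentially
    proof (intro conjI allI impI fI)
      fix \<epsilon> :: real assume "\<epsilon> > 0"
      then obtain N where "\<forall>m\<ge>N. ip_norm (ell2_inner I) (\<sigma> m - f) \<le> \<epsilon> / 2"
        using close[of "\<epsilon> / 2"] by auto
      then show "\<exists>N. \<forall>n\<ge>N. \<sigma> n \<in> ell2 I \<and> ?d (\<sigma> n) f < \<epsilon>"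
        using \<sigma> \<open>\<epsilon> > 0\<close> unfolding ip_dist_def by (force intro!: exI[of _ N])
    qed
    then show "\<exists>x. limitin mtopology \<sigma> x sequentially"
      by blast
  qed
qed

theorem hilbert_space_ell2:
  "hilbert_space fun_scale (ell2 I) (ell2_inner I :: ('i \<Rightarrow> 'k::real_or_complex) \<Rightarrow> _ \<Rightarrow> 'k)"
proof
  show "fun_scale.subspace (ell2 I :: ('i \<Rightarrow> 'k) set)"
    by (rule ell2_subspace)
  show "Metric_space.mcomplete (ell2 I) (ip_dist (ell2_inner I :: ('i \<Rightarrow> 'k) \<Rightarrow> _ \<Rightarrow> 'k))"
    by (rule ell2_complete)
  fix f g h :: "'i \<Rightarrow> 'k"
  assume f: "f \<in> ell2 I"
  show "\<exists>r>0. ell2_inner I f f = of_real r" if "f \<noteq> 0"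
  proof -
    have "(ip_norm (ell2_inner I) f)\<^sup>2 > 0"
      using that ell2_norm_eq_0[OF f] by simp
    then show ?thesis
      using ell2_inner_self[OF f] ell2_norm_sq[OF f] by auto
  qed
  assume g: "g \<in> ell2 I"
  show "ell2_inner I (fun_scale c f) g = c * ell2_inner I f g" for c
    unfolding ell2_inner_def fun_scale_def mult.assoc
    by (rule infsum_cmult_right) (rule ell2_summable[OF f g])
  have "ell2_inner I g f = (\<Sum>\<^sub>\<infinity>i\<in>I. sconj (f i * sconj (g i)))"
    by (simp add: ell2_inner_def sconj_mult mult.commute)
  also have "\<dots> = sconj (ell2_inner I f g)"
    unfolding ell2_inner_def
    by (intro infsumI has_sum_bounded_linear[OF bounded_linear_sconj] has_sum_infsum
        ell2_summable[OF f g])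
  finally show "ell2_inner I g f = sconj (ell2_inner I f g)" .
  assume h: "h \<in> ell2 I"
  show "ell2_inner I (f + g) h = ell2_inner I f h + ell2_inner I g h"
    using infsum_add[OF ell2_summable[OF f h] ell2_summable[OF g h]]
    by (simp add: ell2_inner_def distrib_right)
qed

theorem orthonormal_basis_ell2_unit:
  "orthonormal_basis fun_scale (ell2 I) (ell2_inner I) (ell2_unit ` I :: ('i \<Rightarrow> 'k::real_or_complex) set)"
proof -
  let ?U = "ell2_unit ` I :: ('i \<Rightarrow> 'k) set"
  let ?d = "ip_dist (ell2_inner I :: ('i \<Rightarrow> 'k) \<Rightarrow> _ \<Rightarrow> 'k)"
  interpret Metric_space "ell2 I" ?d
    by (rule ell2_Metric_space)
  have unit: "ell2_unit i \<in> (ell2 I :: ('i \<Rightarrow> 'k) set)" if "i \<in> I" for i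
    using that
    by (auto simp: ell2_def ell2_unit_def split: if_splits
        intro!: has_sum_imp_summable[OF has_sum_finite_neutralI[of "{i}"]])
  have ip: "ell2_inner I (ell2_unit i) (ell2_unit j :: 'i \<Rightarrow> 'k) = (if i = j then 1 else 0)"
    if "i \<in> I" for i j
    unfolding ell2_inner_def
    by (rule infsumI, rule has_sum_finite_neutralI[of "{i}"]) (use that in \<open>auto simp: ell2_unit_def\<close>)
  have [simp]: "ell2_unit i = (ell2_unit j :: 'i \<Rightarrow> 'k) \<longleftrightarrow> i = j" for i j
    by (metis ell2_unit_def zero_neq_one)
  have "orthonormal (ell2_inner I) ?U"
    using ip by (auto simp: orthonormal_def)
  moreover have "closed_span fun_scale (ell2 I) (ell2_inner I) ?U = ell2 I"
    unfolding closed_span_def ip_topology_def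
  proof
    show "ell2 I \<subseteq> mtopology closure_of fun_scale.span ?U"
    proof
      fix f :: "'i \<Rightarrow> 'k" assume f: "f \<in> ell2 I"
      have "\<exists>g\<in>fun_scale.span ?U. g \<in> mball f r" if r: "r > 0" for r
      proof -
        let ?n = "\<lambda>i. (norm (f i))\<^sup>2"
        have sm: "?n summable_on I"
          using f by (auto simp: ell2_def)
        obtain F where F: "finite F" "F \<subseteq> I" "dist (sum ?n F) (infsum ?n I) \<le> r\<^sup>2 / 2"
          using infsum_finite_approximation[OF sm, of "r\<^sup>2 / 2"] r by auto
        define g where "g = (\<Sum>i\<in>F. fun_scale (f i) (ell2_unit i :: 'i \<Rightarrow> 'k))"
        have g: "g i = (if i \<in> F then f i else 0)" for i
        proof -
          have "g i = (\<Sum>j\<in>F. fun_scale (f j) (ell2_unit j :: 'i \<Rightarrow> 'k) i)"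
            unfolding g_def using F(1) by (induction F) auto
          also have "\<dots> = (\<Sum>j\<in>F. if i = j then f j else 0)"
            by (intro sum.cong) (auto simp: fun_scale_def ell2_unit_def)
          finally show ?thesis using F(1) by simp
        qed
        have gs: "g \<in> fun_scale.span ?U"
          unfolding g_def using F(2)
          by (intro fun_scale.span_sum fun_scale.span_scale fun_scale.span_base) auto
        have gI: "g \<in> ell2 I"
          using gs unit fun_scale.span_minimal[OF _ ell2_subspace, of ?U] by blast
        have fg: "f - g \<in> ell2 I"
          by (rule fun_scale.subspace_diff[OF ell2_subspace f gI])
        have "(ip_norm (ell2_inner I) (f - g))\<^sup>2 = (\<Sum>\<^sub>\<infinity>i\<in>I. (norm ((f - g) i))\<^sup>2)"
          by (rule ell2_norm_sq[OF fg])
        also have "\<dots> = (\<Sum>\<^sub>\<infinity>i\<in>I - F. ?n i)"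
          by (rule infsum_cong_neutral) (auto simp: g)
        also have "\<dots> = infsum ?n I - sum ?n F"
          using infsum_Diff[OF sm _ F(2)] F(1) by simp
        also have "\<dots> \<le> r\<^sup>2 / 2"
          using F(3) unfolding dist_real_def by (metis abs_le_D2 minus_diff_eq)
        also have "\<dots> < r\<^sup>2"
          using r by simp
        finally have "ip_norm (ell2_inner I) (f - g) < r"
          using r by (simp add: power2_less_imp_less)
        then have "g \<in> mball f r"
          using f gI by (simp add: ip_dist_def)
        with gs show ?thesis by blast
      qed
      with f show "f \<in> mtopology closure_of fun_scale.span ?U"
        unfolding metric_closure_of by blast
    qed
  qed (use closure_of_subset_topspace in force)
  ultimately show ?thesis
    using unit by (auto simp: orthonormal_basis_def)
qed

corollary tensor_space_adequate:
  fixes e :: "nat \<Rightarrow> 'a"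
  shows "hilbert_space fun_scale (tensor_space B e)
      (tensor_inner B e :: ((nat \<Rightarrow> 'a) \<Rightarrow> 'k::real_or_complex) \<Rightarrow> _ \<Rightarrow> 'k)"
    and "orthonormal_basis fun_scale (tensor_space B e)
      (tensor_inner B e :: ((nat \<Rightarrow> 'a) \<Rightarrow> 'k) \<Rightarrow> _ \<Rightarrow> 'k) (ell2_unit ` formal_products B e)"
  unfolding tensor_space_def tensor_inner_def
  by (rule hilbert_space_ell2, rule orthonormal_basis_ell2_unit)

end

theory Submission
  imports Defs
begin

text \<open>
  Only finitely many factors of a formal product differ from the stabilizing sequence, so every
  formal product lies in some level. The levels increase, hence a finite linear combination of
  formal products lies in a single level, and these combinations are dense.
\<close>

text \<open>A union of subspaces is a subspace as soon as any two of them lie in a common third;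
  monotonicity provides one at the index \<open>max m n\<close>. The union of the spans is then a
  subspace containing every generator.\<close>

lemma (in module) span_UN_incseq:
  assumes "incseq S"
  shows "span (\<Union>n. S n) = (\<Union>n. span (S n))"
proof
  have "subspace (\<Union>n. span (S n))"
  proof (rule subspaceI)
    fix x y assume "x \<in> (\<Union>n. span (S n))" "y \<in> (\<Union>n. span (S n))"
    then obtain m n where mn: "x \<in> span (S m)" "y \<in> span (S n)"
      by auto
    have "span (S m) \<subseteq> span (S (max m n))" "span (S n) \<subseteq> span (S (max m n))"
      by (intro span_mono incseqD[OF assms] max.cobounded1 max.cobounded2)+
    with mn have "x + y \<in> span (S (max m n))"
      by (intro span_add) auto
    then show "x + y \<in> (\<Union>n. span (S n))"
      by blast
  qed (auto intro: span_zero span_scale)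
  then show "span (\<Union>n. S n) \<subseteq> (\<Union>n. span (S n))"
    by (intro span_minimal) (auto intro: span_base)
qed (intro UN_least span_mono UN_upper UNIV_I)

lemma formal_products_eventually_stable:
  assumes "b \<in> formal_products B e"
  obtains l where "\<And>n. n \<ge> l + 1 \<Longrightarrow> b n = e n"
proof -
  have "finite {n \<in> {1..}. b n \<noteq> e n}"
    using assms unfolding formal_products_def by blast
  then obtain l where l: "\<forall>n\<in>{n \<in> {1..}. b n \<noteq> e n}. n < l"
    unfolding finite_nat_set_iff_bounded by blast
  have "b n = e n" if "n \<ge> l + 1" for n
  proof (rule ccontr)
    assume "b n \<noteq> e n"
    \<comment> \<open>The bound \<open>l + 1\<close> keeps \<open>n\<close> away from index 0, which
      is no factor and where \<open>b\<close> is \<open>undefined\<close>.\<close>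
    with that have "n \<in> {n \<in> {1..}. b n \<noteq> e n}"
      by simp
    with l have "n < l"
      by blast
    with that show False
      by simp
  qed
  then show ?thesis
    by (rule that)
qed

theorem lemma4p2:
  fixes smul :: "'k::real_or_complex \<Rightarrow> 'a::ab_group_add \<Rightarrow> 'a"
    and H X B C :: "nat \<Rightarrow> 'a set"
    and ip :: "nat \<Rightarrow> 'a \<Rightarrow> 'a \<Rightarrow> 'k"
    and e :: "nat \<Rightarrow> 'a"
  assumes hilbert: "\<And>n. n \<ge> 1 \<Longrightarrow> hilbert_space smul (H n) (ip n)"
    and separable: "\<And>n. n \<ge> 1 \<Longrightarrow> separable_space (ip_topology (H n) (ip n))"
    and closed_subspaces: "\<And>n. n \<ge> 1 \<Longrightarrow> closed_subspace smul (H n) (ip n) (X n)"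
    and e_mem: "\<And>n. n \<ge> 1 \<Longrightarrow> e n \<in> X n"
    and e_unit: "\<And>n. n \<ge> 1 \<Longrightarrow> ip_norm (ip n) (e n) = 1"
    and basis_X: "\<And>n. n \<ge> 1 \<Longrightarrow> orthonormal_basis smul (X n) (ip n) (C n)"
    and e_basis: "\<And>n. n \<ge> 1 \<Longrightarrow> e n \<in> C n"
    and basis_extends: "\<And>n. n \<ge> 1 \<Longrightarrow> C n \<subseteq> B n"
    and basis_H: "\<And>n. n \<ge> 1 \<Longrightarrow> orthonormal_basis smul (H n) (ip n) (B n)"
  shows "(tensor_space B e :: ((nat \<Rightarrow> 'a) \<Rightarrow> 'k) set) =
    ip_topology (tensor_space B e) (tensor_inner B e) closure_of (\<Union>l\<in>{1..}. tensor_level B e X l)"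
proof -
  let ?T = "ip_topology (tensor_space B e :: ((nat \<Rightarrow> 'a) \<Rightarrow> 'k) set) (tensor_inner B e)"
  \<comment> \<open>\<open>S l\<close> generates level \<open>l\<close>. It is indexed from 0, so
    that the union runs over all of \<open>nat\<close> as in \<open>span_UN_incseq\<close>.\<close>
  define S :: "nat \<Rightarrow> ((nat \<Rightarrow> 'a) \<Rightarrow> 'k) set"
    where "S l = ell2_unit ` {b \<in> formal_products B e. \<forall>n\<ge>l + 1. b n \<in> X n}" for l
  let ?U = "ell2_unit ` formal_products B e :: ((nat \<Rightarrow> 'a) \<Rightarrow> 'k) set"
  have top: "topspace ?T = tensor_space B e"
    unfolding ip_topology_def tensor_space_def tensor_inner_def
    by (rule Metric_space.topspace_mtopology[OF ell2_Metric_space])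
  \<comment> \<open>Density enters here: finite linear combinations of formal products are dense in
    the model.\<close>
  have basis: "?U \<subseteq> tensor_space B e" "?T closure_of fun_scale.span ?U = tensor_space B e"
    using tensor_space_adequate(2)[where 'k = 'k, of B e]
    unfolding orthonormal_basis_def closed_span_def by auto
  \<comment> \<open>A larger \<open>l\<close> constrains fewer factors.\<close>
  have "incseq S"
    unfolding S_def by (intro incseq_SucI) auto
  have "?U \<subseteq> (\<Union>l. S l)"
  proof (intro image_subsetI)
    fix b assume b: "b \<in> formal_products B e"
    then obtain l where "\<And>n. n \<ge> l + 1 \<Longrightarrow> b n = e n"
      using formal_products_eventually_stable by blast
    \<comment> \<open>Beyond \<open>l\<close> the factors of \<open>b\<close> are those of
      \<open>e\<close>, which lie in \<open>X n\<close> by \<open>e_mem\<close>.\<close>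
    with b have "ell2_unit b \<in> S l"
      using e_mem by (auto simp: S_def)
    then show "ell2_unit b \<in> (\<Union>l. S l)"
      by blast
  qed
  then have "fun_scale.span ?U \<subseteq> (\<Union>l. fun_scale.span (S l))"
    unfolding fun_scale.span_UN_incseq[OF \<open>incseq S\<close>, symmetric] by (rule fun_scale.span_mono)
  also have "\<dots> \<subseteq> (\<Union>l\<in>{1..}. tensor_level B e X l)"
  proof (rule UN_least)
    fix l
    \<comment> \<open>The union of levels starts at 1, so \<open>S l\<close> is pushed into level
      \<open>Suc l\<close>; this also covers \<open>l = 0\<close>.\<close>
    have "S (Suc l) \<subseteq> tensor_space B e"
      using basis(1) by (auto simp: S_def)
    \<comment> \<open>A set lies in its closure only if it lies in the carrier of the
      topology.\<close>
    then have "fun_scale.span (S (Suc l)) \<subseteq> topspace ?T"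
      unfolding top by (rule fun_scale.span_minimal) (simp add: tensor_space_def ell2_subspace)
    then have "fun_scale.span (S (Suc l)) \<subseteq> tensor_level B e X (Suc l)"
      unfolding tensor_level_def closed_span_def S_def[symmetric] by (rule closure_of_subset)
    moreover have "fun_scale.span (S l) \<subseteq> fun_scale.span (S (Suc l))"
      by (intro fun_scale.span_mono incseq_SucD[OF \<open>incseq S\<close>])
    moreover have "tensor_level B e X (Suc l) \<subseteq> (\<Union>l\<in>{1..}. tensor_level B e X l)"
      by (rule UN_upper) simp
    ultimately show "fun_scale.span (S l) \<subseteq> (\<Union>l\<in>{1..}. tensor_level B e X l)"
      by (meson subset_trans)
  qed
  finally have "?T closure_of fun_scale.span ?U \<subseteq> ?T closure_of (\<Union>l\<in>{1..}. tensor_level B e X l)"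
    by (rule closure_of_mono)
  then have "tensor_space B e \<subseteq> ?T closure_of (\<Union>l\<in>{1..}. tensor_level B e X l)"
    unfolding basis(2) .
  moreover have "?T closure_of (\<Union>l\<in>{1..}. tensor_level B e X l) \<subseteq> tensor_space B e"
    using closure_of_subset_topspace[of ?T] unfolding top .
  ultimately show ?thesis
    by (rule subset_antisym)
qed

end
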